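(* Let $H\in\mathbb{C}^{N\times N}$ be a Hermitian negative definite matrix and define $E_0:\mathbb{C}^{N\times m}\to\mathbb{R}$ by $E_0(X)=\operatorname{tr}\bigl[(2I-X^*X)X^*HX\bigr]$. Then any local minimum of $E_0$ is also a global minimum of $E_0$.
   Context: $N,m$ are positive integers, $X^*$ denotes the conjugate transpose of $X$, and $I$ is the $m\times m$ identity matrix. Local and global minima are taken over all of $\mathbb{C}^{N\times m}$ with its usual topology; a local (global) minimum means a point $X$ that is a local (global) minimizer. *)

theory Defs
  imports "HOL-Analysis.Analysis"
begin

text \<open>An \<open>N \<times> m\<close> complex matrix is an element of \<^typ>\<open>complex^'m^'N\<close> (rows indexed by \<open>'N\<close>,
  columns by \<open>'m\<close>), so that \<open>N = CARD('N)\<close> and \<open>m = CARD('m)\<close> are positive.\<close>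

definition ctranspose :: "complex^'n^'m \<Rightarrow> complex^'m^'n" where
  "ctranspose A = (\<chi> i j. cnj (A $ j $ i))"

definition hermitian :: "complex^'n^'n \<Rightarrow> bool" where
  "hermitian A \<longleftrightarrow> ctranspose A = A"

text \<open>The form \<open>x\<^sup>* A x\<close> is real for Hermitian \<open>A\<close>; \<^const>\<open>Re\<close> only serves as a coercion.\<close>

definition hermitian_neg_def :: "complex^'n^'n \<Rightarrow> bool" where
  "hermitian_neg_def A \<longleftrightarrow>
     hermitian A \<and> (\<forall>x. x \<noteq> 0 \<longrightarrow> Re (\<Sum>i\<in>UNIV. cnj (x $ i) * (A *v x) $ i) < 0)"

text \<open>The trace below is real for Hermitian \<open>H\<close> (lemma \<open>E0_trace_real\<close>), so taking \<^const>\<open>Re\<close>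
  loses nothing. The matrix \<open>mat 2\<close> is \<open>2I\<close>.\<close>

definition E0 :: "complex^'N^'N \<Rightarrow> complex^'m^'N \<Rightarrow> real" where
  "E0 H X = Re (trace ((mat 2 - ctranspose X ** X) ** (ctranspose X ** H ** X)))"

definition local_minimum :: "('a::topological_space \<Rightarrow> real) \<Rightarrow> 'a \<Rightarrow> bool" where
  "local_minimum f x \<longleftrightarrow> (\<forall>\<^sub>F y in nhds x. f x \<le> f y)"

definition global_minimum :: "('a \<Rightarrow> real) \<Rightarrow> 'a \<Rightarrow> bool" where
  "global_minimum f x \<longleftrightarrow> (\<forall>y. f x \<le> f y)"

lemma ctranspose_mult: "ctranspose (A ** B) = ctranspose B ** ctranspose A"
  by (simp add: ctranspose_def matrix_matrix_mult_def vec_eq_iff mult.commute)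

lemma ctranspose_ctranspose [simp]: "ctranspose (ctranspose A) = A"
  by (simp add: ctranspose_def vec_eq_iff)

lemma trace_ctranspose: "trace (ctranspose A) = cnj (trace A)"
  by (simp add: ctranspose_def trace_def)

lemma hermitian_form_real:
  assumes "hermitian A"
  shows "(\<Sum>i\<in>UNIV. cnj (x $ i) * (A *v x) $ i) \<in> \<real>"
proof -
  have A: "cnj (A $ i $ j) = A $ j $ i" for i j
    using assms unfolding hermitian_def ctranspose_def by (metis vec_lambda_beta)
  have "cnj (\<Sum>i\<in>UNIV. cnj (x $ i) * (A *v x) $ i)
      = (\<Sum>i\<in>UNIV. \<Sum>j\<in>UNIV. x $ i * (A $ j $ i * cnj (x $ j)))"
    by (simp add: matrix_vector_mult_def sum_distrib_left A)
  also have "\<dots> = (\<Sum>i\<in>UNIV. cnj (x $ i) * (A *v x) $ i)"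
    by (subst sum.swap) (simp add: matrix_vector_mult_def sum_distrib_left mult_ac)
  finally show ?thesis by (simp add: Reals_cnj_iff)
qed

lemma E0_trace_real:
  fixes H :: "complex^'N^'N" and X :: "complex^'m^'N"
  assumes "hermitian H"
  shows "trace ((mat 2 - ctranspose X ** X) ** (ctranspose X ** H ** X)) \<in> \<real>"
proof -
  let ?A = "mat 2 - ctranspose X ** X" and ?B = "ctranspose X ** H ** X"
  have "ctranspose (mat 2 - C) = mat 2 - ctranspose C" for C :: "complex^'m^'m"
    by (simp add: ctranspose_def mat_def vec_eq_iff)
  then have A: "ctranspose ?A = ?A" by (simp add: ctranspose_mult)
  have B: "ctranspose ?B = ?B"
    using assms by (simp add: hermitian_def ctranspose_mult matrix_mul_assoc)
  have "cnj (trace (?A ** ?B)) = trace (?B ** ?A)"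
    by (metis A B ctranspose_mult trace_ctranspose)
  also have "\<dots> = trace (?A ** ?B)" by (rule trace_mul_sym)
  finally show ?thesis by (simp add: Reals_cnj_iff)
qed

end

theory Submission
  imports Defs
begin

text \<open>With \<open>P = XX\<^sup>*\<close> the energy is \<open>tr (H(2P - P\<^sup>2)) = tr H - tr ((I - P)H(I - P))\<close>. At a local minimum
  the first-order condition forces \<open>P\<close> to be an orthogonal projection commuting with \<open>H\<close>. The
  second-order condition gives either \<open>P = I\<close>, where the energy is \<open>tr H\<close> and hence minimal, or
  \<open>X\<^sup>*X = I\<close>, and in the latter case a number \<open>\<mu> \<le> 0\<close> separating the values of \<open>H\<close> on the range of \<open>P\<close>
  from those on its orthogonal complement. Conversely, if \<open>S\<close> is an orthogonal projection of rank at
  most \<open>m\<close> fixing the columns of \<open>Y\<close>, then \<open>E\<^sub>0(Y) \<ge> tr (HS)\<close>, and the separation shows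
  \<open>tr (HS) \<ge> tr (HP) = E\<^sub>0(X)\<close>.\<close>

section \<open>Matrix algebra\<close>

lemma matrix_scaleR_mult:
  fixes A :: "complex^'m^'n" and B :: "complex^'k^'m"
  shows "(r *\<^sub>R A) ** B = r *\<^sub>R (A ** B)" and "A ** (r *\<^sub>R B) = r *\<^sub>R (A ** B)"
  by (simp_all add: matrix_matrix_mult_def vec_eq_iff scaleR_sum_right)

lemma matrix_distrib:
  fixes A B :: "complex^'m^'n" and C D :: "complex^'k^'m"
  shows "(A + B) ** C = A ** C + B ** C" and "(A - B) ** C = A ** C - B ** C" and "A ** (C - D) = A ** C - A ** D"
  by (simp_all add: matrix_matrix_mult_def vec_eq_iff algebra_simps sum_subtractf sum.distrib)

lemma matrix_mult_zero:
  fixes A :: "complex^'m^'n"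
  shows "(0::complex^'n^'k) ** A = 0" and "A ** (0::complex^'k^'m) = 0"
  by (simp_all add: matrix_matrix_mult_def vec_eq_iff)

lemma mat_2_mult:
  fixes A :: "complex^'m^'n"
  shows "mat 2 ** A = A + A"
proof -
  have "(mat 2 :: complex^'n^'n) = mat 1 + mat 1"
    by (simp add: mat_def vec_eq_iff)
  then show ?thesis by (simp only: matrix_distrib matrix_mul_lid)
qed

text \<open>The numeral \<open>2\<close> below is the constant matrix with componentwise multiplication; the simplifier
  introduces it when it normalizes \<open>A + A\<close>.\<close>

lemma matrix_double:
  fixes A :: "complex^'m^'n" and B :: "complex^'k^'m"
  shows "(2 * A) ** B = 2 * (A ** B)" and "A ** (2 * B) = 2 * (A ** B)"
    and "ctranspose (2 * A) = 2 * ctranspose A"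
  by (simp_all only: mult_2 matrix_distrib matrix_add_ldistrib)
    (simp add: ctranspose_def vec_eq_iff)

lemma ctranspose_linear:
  "ctranspose (A + B) = ctranspose A + ctranspose B"
  "ctranspose (A - B) = ctranspose A - ctranspose B"
  "ctranspose (r *\<^sub>R A) = r *\<^sub>R ctranspose A"
  "ctranspose 0 = 0"
  "ctranspose (mat 1) = mat 1"
  by (simp_all add: ctranspose_def vec_eq_iff mat_def)

text \<open>A normal form for matrix expressions: sums pulled out of products, conjugate transposes
  pushed onto single factors, products associated to the left.\<close>

lemmas matrix_expand = matrix_add_ldistrib matrix_distrib
  matrix_scaleR_mult ctranspose_linear ctranspose_mult matrix_mul_assoc matrix_mult_zero matrix_double

section \<open>Real traces, columns and Gram matrices\<close>

definition re_trace :: "complex^'n^'n \<Rightarrow> real" where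
  "re_trace A = Re (trace A)"

lemma re_trace_linear:
  "re_trace (A + B) = re_trace A + re_trace B"
  "re_trace (A - B) = re_trace A - re_trace B"
  "re_trace (r *\<^sub>R A) = r * re_trace A"
  "re_trace (2 * A) = 2 * re_trace A"
  "re_trace 0 = 0"
  by (simp_all add: re_trace_def trace_def sum.distrib sum_subtractf sum_distrib_left)

lemma re_trace_mat_1: "re_trace (mat 1 :: complex^'n^'n) = CARD('n)"
  by (simp add: re_trace_def trace_I)

lemma re_trace_mult_commute:
  fixes A :: "complex^'n^'m"
  shows "re_trace (A ** B) = re_trace (B ** A)"
  unfolding re_trace_def by (rule arg_cong[OF trace_mul_sym])

lemma mult_columnvector_column:
  fixes A :: "complex^'m^'n" and Z :: "complex^'k^'m"
  shows "A ** columnvector (column j Z) = columnvector (column j (A ** Z))"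
  by (simp add: matrix_matrix_mult_def columnvector_def column_def vec_eq_iff)

lemma diag_congruence:
  fixes A :: "complex^'n^'n" and Z :: "complex^'k^'n"
  shows "(ctranspose Z ** A ** Z) $ j $ j = (\<Sum>i\<in>UNIV. cnj (Z $ i $ j) * (A *v column j Z) $ i)"
proof -
  have "ctranspose Z ** A ** Z = ctranspose Z ** (A ** Z)"
    by (simp only: matrix_mul_assoc)
  also have "\<dots> $ j $ j = (\<Sum>i\<in>UNIV. cnj (Z $ i $ j) * (A *v column j Z) $ i)"
    unfolding matrix_matrix_mult_def matrix_vector_mult_def ctranspose_def column_def by simp
  finally show ?thesis .
qed

text \<open>Each diagonal entry of the congruence involves one column of \<open>Z\<close> only.
  Inequalities between quadratic forms thus pass from vectors, written as one-column matrices, to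
  arbitrary \<open>Z\<close>.\<close>

lemma re_trace_congruence_columns:
  fixes A :: "complex^'n^'n" and Z :: "complex^'k^'n"
  shows "re_trace (ctranspose Z ** A ** Z) = (\<Sum>j\<in>UNIV. re_trace
    (ctranspose (columnvector (column j Z) :: complex^1^'n) ** A ** columnvector (column j Z)))"
proof -
  have "column 1 (columnvector z :: complex^1^'n) = z" for z
    by (simp add: column_def columnvector_def vec_eq_iff)
  then show ?thesis
    by (simp add: re_trace_def trace_def diag_congruence UNIV_1)
      (simp add: columnvector_def column_def)
qed

lemma re_trace_gram: "re_trace (ctranspose Z ** Z) = (\<Sum>j\<in>UNIV. \<Sum>i\<in>UNIV. (cmod (Z $ i $ j))\<^sup>2)"
  by (simp add: re_trace_def trace_def matrix_matrix_mult_def ctranspose_def cmod_power2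
      flip: power2_eq_square)

lemma re_trace_gram_nonneg: "0 \<le> re_trace (ctranspose Z ** Z)"
  by (simp add: re_trace_gram sum_nonneg)

lemma re_trace_gram_eq_0_iff: "re_trace (ctranspose Z ** Z) = 0 \<longleftrightarrow> Z = 0"
  by (auto simp: re_trace_gram sum_nonneg_eq_0_iff sum_nonneg vec_eq_iff)

text \<open>The squared norm of a vector is a 1 by 1 matrix; in this form it can be pulled out of a
  longer product as a real scalar.\<close>

lemma gram_column:
  fixes u :: "complex^1^'n"
  shows "ctranspose u ** u = re_trace (ctranspose u ** u) *\<^sub>R mat 1"
proof -
  have "cnj z * z = of_real ((cmod z)\<^sup>2)" for z
    by (metis complex_norm_square mult.commute)
  then have "(ctranspose u ** u) $ 1 $ 1 = of_real (re_trace (ctranspose u ** u))"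
    unfolding re_trace_gram by (simp add: UNIV_1 matrix_matrix_mult_def ctranspose_def)
  then show ?thesis
    by (simp add: vec_eq_iff mat_def num1_eq1 complex_eq_iff)
qed

section \<open>Negative definite forms\<close>

lemma neg_def_form_diag:
  assumes "hermitian_neg_def H"
  shows "Re ((ctranspose Z ** H ** Z) $ j $ j) \<le> 0"
    and "column j Z \<noteq> 0 \<Longrightarrow> Re ((ctranspose Z ** H ** Z) $ j $ j) < 0"
proof -
  have eq: "(ctranspose Z ** H ** Z) $ j $ j
      = (\<Sum>i\<in>UNIV. cnj (column j Z $ i) * (H *v column j Z) $ i)"
    by (simp only: diag_congruence) (simp add: column_def)
  show *: "column j Z \<noteq> 0 \<Longrightarrow> Re ((ctranspose Z ** H ** Z) $ j $ j) < 0"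
    unfolding eq using assms by (simp add: hermitian_neg_def_def)
  show "Re ((ctranspose Z ** H ** Z) $ j $ j) \<le> 0"
  proof (cases "column j Z = 0")
    case True
    then show ?thesis unfolding eq by simp
  next
    case False
    with * show ?thesis by simp
  qed
qed

lemma neg_def_form_nonpos:
  assumes "hermitian_neg_def H"
  shows "re_trace (ctranspose Z ** H ** Z) \<le> 0"
  unfolding re_trace_def trace_def Re_sum
  by (intro sum_nonpos neg_def_form_diag(1) assms)

text \<open>All diagonal entries are nonpositive, and a nonzero column makes one of them strictly
  negative. Later this turns trace identities into matrix equations.\<close>

lemma neg_def_form_definite:
  assumes "hermitian_neg_def H" and "0 \<le> re_trace (ctranspose Z ** H ** Z)"
  shows "Z = 0"
proof (rule ccontr)
  assume "Z \<noteq> 0"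
  then obtain j where j: "column j Z \<noteq> 0"
    by (auto simp: vec_eq_iff column_def)
  have "re_trace (ctranspose Z ** H ** Z) < (\<Sum>j\<in>(UNIV :: 'b set). 0)"
    unfolding re_trace_def trace_def Re_sum
    using neg_def_form_diag(1)[OF assms(1)] neg_def_form_diag(2)[OF assms(1) j]
    by (intro sum_strict_mono_ex1) auto
  with assms(2) show False by simp
qed

lemma neg_def_ctranspose: "hermitian_neg_def H \<Longrightarrow> ctranspose H = H"
  by (simp add: hermitian_neg_def_def hermitian_def)

section \<open>Orthogonal projections\<close>

definition orth_proj :: "complex^'n^'n \<Rightarrow> bool" where
  "orth_proj P \<longleftrightarrow> ctranspose P = P \<and> P ** P = P"

text \<open>The third fact is idempotence in the shape that it takes inside left-associated
  products.\<close>

lemma orth_projD: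
  assumes "orth_proj P"
  shows "ctranspose P = P" and "P ** P = P" and "A ** P ** P = A ** P"
  using assms by (auto simp: orth_proj_def simp flip: matrix_mul_assoc)

lemma orth_proj_compl: "orth_proj P \<Longrightarrow> orth_proj (mat 1 - P)"
  by (simp add: orth_proj_def matrix_expand)

text \<open>Gram--Schmidt: adjoining one vector enlarges the projection by \<open>zz\<^sup>*/|z|\<^sup>2\<close>, where \<open>z\<close> is
  the component of that vector orthogonal to the previous ones.\<close>

lemma orth_proj_columns_aux:
  fixes Y :: "complex^'m^'n"
  assumes "finite J"
  shows "\<exists>S. orth_proj S \<and> re_trace S \<le> card J \<and>
    (\<forall>j\<in>J. S ** columnvector (column j Y) = (columnvector (column j Y) :: complex^1^'n))"
  using assms
proof (induction J rule: finite_induct)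
  case empty
  show ?case
    by (rule exI[of _ 0]) (simp add: orth_proj_def matrix_expand re_trace_linear)
next
  case (insert j J)
  then obtain S where S: "orth_proj S" "re_trace S \<le> card J"
    and cols: "\<And>j. j \<in> J \<Longrightarrow>
      S ** columnvector (column j Y) = (columnvector (column j Y) :: complex^1^'n)"
    by blast
  note SD = orth_projD[OF S(1)]
  define y z :: "complex^1^'n" where "y = columnvector (column j Y)" and "z = y - S ** y"
  define a where "a = re_trace (ctranspose z ** z)"
  show ?case
  proof (cases "z = 0")
    case True
    then show ?thesis using S cols insert.hyps
      by (intro exI[of _ S]) (auto simp: z_def y_def)
  next
    case False
    then have a: "a \<noteq> 0" by (simp add: a_def re_trace_gram_eq_0_iff)
    have Sz: "S ** z = 0" by (simp add: z_def matrix_expand SD)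
    then have zS: "ctranspose z ** S = 0"
      by (metis SD(1) ctranspose_linear(4) ctranspose_mult)
    have zz: "ctranspose z ** z = a *\<^sub>R mat 1"
      unfolding a_def by (rule gram_column)
    define S' where "S' = S + (1 / a) *\<^sub>R (z ** ctranspose z)"
    have "z ** ctranspose z ** S = 0" "z ** ctranspose z ** z = a *\<^sub>R z"
      by (simp_all add: zS zz matrix_expand flip: matrix_mul_assoc)
    then have "orth_proj S'"
      using a by (simp add: S'_def orth_proj_def matrix_expand SD Sz)
    moreover have "re_trace S' \<le> card (insert j J)"
      using S(2) a insert.hyps re_trace_mult_commute[of z "ctranspose z"]
      by (simp add: S'_def re_trace_linear a_def)
    moreover have "S' ** columnvector (column i Y) = (columnvector (column i Y) :: complex^1^'n)"
      if "i \<in> insert j J" for i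
    proof (cases "i = j")
      case True
      have y: "y = z + S ** y" by (simp add: z_def)
      have "S' ** z = z" "S' ** (S ** y) = S ** y"
        using a by (simp_all add: S'_def matrix_expand SD Sz \<open>z ** ctranspose z ** S = 0\<close>
            \<open>z ** ctranspose z ** z = a *\<^sub>R z\<close>)
      then have "S' ** y = y" by (metis y matrix_add_ldistrib)
      with True show ?thesis by (simp add: y_def)
    next
      case False
      then have i: "S ** columnvector (column i Y) = (columnvector (column i Y) :: complex^1^'n)"
        using that cols by simp
      \<comment> \<open>The enlarged projection still fixes everything that \<open>S\<close>
        fixes.\<close>
      have "S' ** S = S" by (simp add: S'_def matrix_expand SD \<open>z ** ctranspose z ** S = 0\<close>)
      then show ?thesis by (metis i matrix_mul_assoc)
    qed
    ultimately show ?thesis by blast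
  qed
qed

text \<open>The trace of an orthogonal projection is its rank, so the second property is a rank
  bound.\<close>

lemma orth_proj_columns:
  fixes Y :: "complex^'m^'n"
  obtains S where "orth_proj S" and "re_trace S \<le> CARD('m)" and "S ** Y = Y"
proof -
  obtain S where S: "orth_proj S" "re_trace S \<le> CARD('m)"
    and cols: "\<And>j. S ** columnvector (column j Y) = (columnvector (column j Y) :: complex^1^'n)"
    using orth_proj_columns_aux[of UNIV Y] by auto
  have "column j (S ** Y) = column j Y" for j
    using cols[of j] unfolding mult_columnvector_column by (simp add: columnvector_def vec_eq_iff)
  then have "S ** Y = Y" by (simp add: column_def vec_eq_iff)
  with S show ?thesis by (rule that)
qed

section \<open>Lower bounds for the energy\<close>

text \<open>Cyclicity of the trace shows that the energy depends on \<open>X\<close> only through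
  \<open>X ** ctranspose X\<close>.\<close>

lemma E0_eq:
  "E0 H X = re_trace
    (H ** (X ** ctranspose X + X ** ctranspose X - X ** ctranspose X ** X ** ctranspose X))"
proof -
  have 1: "re_trace (ctranspose X ** H ** X) = re_trace (H ** X ** ctranspose X)"
    using re_trace_mult_commute[of "ctranspose X" "H ** X"] by (simp add: matrix_mul_assoc)
  have 2: "re_trace (ctranspose X ** X ** ctranspose X ** H ** X)
      = re_trace (H ** X ** ctranspose X ** X ** ctranspose X)"
    using re_trace_mult_commute[of "ctranspose X ** X ** ctranspose X" "H ** X"]
    by (simp add: matrix_mul_assoc)
  show ?thesis
    by (simp add: E0_def matrix_expand mat_2_mult re_trace_linear 1 2 flip: re_trace_def)
qed

text \<open>With \<open>D\<close> the defect of \<open>Y ** ctranspose Y\<close> from the identity,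
  the energy is tr H - tr (DHD). Split the last trace along \<open>S\<close> and its complement
  \<open>R\<close>: the \<open>S\<close> part is a form of \<open>H\<close>, hence nonpositive, and
  on \<open>R\<close> the matrix \<open>D\<close> acts as the identity, which leaves tr
  (HR).\<close>

lemma E0_lower_bound:
  fixes Y :: "complex^'m^'n"
  assumes H: "hermitian_neg_def H" and S: "orth_proj S" and SY: "S ** Y = Y"
  shows "re_trace (H ** S) \<le> E0 H Y"
proof -
  note SD = orth_projD[OF S]
  define D where "D = mat 1 - Y ** ctranspose Y"
  define R where "R = mat 1 - S"
  have R: "orth_proj R" unfolding R_def by (rule orth_proj_compl[OF S])
  note RD = orth_projD[OF R]
  have D: "ctranspose D = D" by (simp add: D_def matrix_expand)
  have "ctranspose Y ** S = ctranspose Y"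
    by (metis SD(1) SY ctranspose_mult)
  then have "ctranspose Y ** R = 0" by (simp add: R_def matrix_expand)
  then have DR: "D ** R = R" by (simp add: D_def matrix_expand flip: matrix_mul_assoc)
  then have RDeq: "R ** D = R" by (metis D RD(1) ctranspose_mult)
  have E: "E0 H Y = re_trace H - re_trace (D ** H ** D)"
  proof -
    have "re_trace (D ** H ** D) = re_trace (H ** D ** D)"
      using re_trace_mult_commute[of D "H ** D"] by (simp add: matrix_mul_assoc)
    then show ?thesis unfolding E0_eq by (simp only:) (simp add: D_def matrix_expand re_trace_linear)
  qed
  have "re_trace (D ** H ** D) = re_trace (D ** H ** D ** S) + re_trace (D ** H ** D ** R)"
    by (simp add: R_def matrix_expand re_trace_linear)
  also have "re_trace (D ** H ** D ** S) = re_trace (ctranspose (D ** S) ** H ** (D ** S))"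
    using re_trace_mult_commute[of "D ** H ** D ** S" S]
    by (simp add: ctranspose_mult D SD matrix_mul_assoc)
  also have "\<dots> \<le> 0" by (rule neg_def_form_nonpos[OF H])
  also have "re_trace (D ** H ** D ** R) = re_trace (H ** R)"
    using re_trace_mult_commute[of "D ** H" R] re_trace_mult_commute[of "R" H]
    by (simp add: DR RDeq matrix_mul_assoc flip: matrix_mul_assoc[of _ D R])
  finally show ?thesis
    by (simp add: E R_def matrix_expand re_trace_linear)
qed

lemma E0_lower_bound_trace:
  assumes "hermitian_neg_def H"
  shows "re_trace H \<le> E0 H Y"
  using E0_lower_bound[OF assms, of "mat 1" Y] by (simp add: orth_proj_def ctranspose_linear)

text \<open>The constraint with two matrices covers both uses: \<open>Q = mat 1\<close> describes
  the vectors fixed by \<open>P\<close>, and \<open>Q = 0\<close> its kernel.\<close>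

lemma re_trace_form_le:
  fixes Z :: "complex^'k^'n"
  assumes "\<And>u :: complex^1^'n. P ** u = Q ** u \<Longrightarrow>
      re_trace (ctranspose u ** A ** u) \<le> re_trace (ctranspose u ** B ** u)"
    and Z: "P ** Z = Q ** Z"
  shows "re_trace (ctranspose Z ** A ** Z) \<le> re_trace (ctranspose Z ** B ** Z)"
  by (subst (1 2) re_trace_congruence_columns, intro sum_mono assms(1))
    (simp add: mult_columnvector_column Z)

text \<open>Ky Fan's trace inequality for \<open>-H\<close>, with \<open>\<mu>\<close> in the gap between the two parts of the spectrum
  in place of ordered eigenvalues.\<close>

lemma re_trace_proj_minimal:
  fixes H P S :: "complex^'n^'n"
  assumes P: "orth_proj P" and S: "orth_proj S" and comm: "P ** H = H ** P"
    and tr: "re_trace S \<le> re_trace P" and mu: "\<mu> \<le> 0"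
    and upper: "\<And>u :: complex^1^'n. P ** u = u \<Longrightarrow>
      re_trace (ctranspose u ** H ** u) \<le> \<mu> * re_trace (ctranspose u ** u)"
    and lower: "\<And>v :: complex^1^'n. P ** v = 0 \<Longrightarrow>
      \<mu> * re_trace (ctranspose v ** v) \<le> re_trace (ctranspose v ** H ** v)"
  shows "re_trace (H ** P) \<le> re_trace (H ** S)"
proof -
  note PD = orth_projD[OF P]
  note SD = orth_projD[OF S]
  \<comment> \<open>Applied below both to \<open>H\<close> and to the scalar matrix for
    \<open>\<mu>\<close>, which commutes with everything.\<close>
  have cyc: "re_trace (ctranspose (T ** U) ** A ** (T ** U)) = re_trace (A ** T ** U)"
    if T: "orth_proj T" and U: "orth_proj U" and comm: "T ** A = A ** T"
    for A T U :: "complex^'n^'n"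
  proof -
    have "ctranspose (T ** U) ** A ** (T ** U) = U ** (T ** A) ** T ** U"
      by (simp only: ctranspose_mult orth_projD(1)[OF T] orth_projD(1)[OF U] matrix_mul_assoc)
    also have "\<dots> = U ** (A ** T ** U)"
      by (simp only: comm orth_projD(3)[OF T] matrix_mul_assoc)
    also have "re_trace \<dots> = re_trace (A ** T ** U)"
      by (subst re_trace_mult_commute) (simp only: orth_projD(3)[OF U])
    finally show ?thesis .
  qed
  have cyc_1: "re_trace (ctranspose (T ** U) ** (\<mu> *\<^sub>R mat 1) ** (T ** U)) = \<mu> * re_trace (T ** U)"
    if "orth_proj T" and "orth_proj U" for T U :: "complex^'n^'n"
    using cyc[OF that, of "\<mu> *\<^sub>R mat 1"] by (simp add: matrix_scaleR_mult re_trace_linear)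
  define T U where "T = mat 1 - P" and "U = mat 1 - S"
  have T: "orth_proj T" and U: "orth_proj U"
    by (simp_all add: T_def U_def P S orth_proj_compl)
  have commT: "T ** H = H ** T" by (simp add: T_def matrix_expand comm)
  have PT: "P ** T = 0" by (simp add: T_def matrix_expand PD)
  have form: "re_trace (ctranspose u ** (\<mu> *\<^sub>R mat 1) ** u) = \<mu> * re_trace (ctranspose u ** u)"
    for u :: "complex^1^'n"
    by (simp add: matrix_scaleR_mult re_trace_linear)
  have "re_trace (ctranspose (P ** U) ** H ** (P ** U))
      \<le> re_trace (ctranspose (P ** U) ** (\<mu> *\<^sub>R mat 1) ** (P ** U))"
  proof (rule re_trace_form_le[where P = P and Q = "mat 1"])
    show "P ** (P ** U) = mat 1 ** (P ** U)" by (simp add: matrix_mul_assoc PD)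
  qed (simp only: form upper matrix_mul_lid)
  then have 1: "re_trace (H ** P ** U) \<le> \<mu> * re_trace (P ** U)"
    by (simp only: cyc[OF P U comm] cyc_1[OF P U])
  have "re_trace (ctranspose (T ** S) ** (\<mu> *\<^sub>R mat 1) ** (T ** S))
      \<le> re_trace (ctranspose (T ** S) ** H ** (T ** S))"
  proof (rule re_trace_form_le[where P = P and Q = 0])
    show "P ** (T ** S) = 0 ** (T ** S)" by (simp add: matrix_mul_assoc PT)
  qed (simp only: form lower matrix_mult_zero)
  then have 2: "\<mu> * re_trace (T ** S) \<le> re_trace (H ** T ** S)"
    by (simp only: cyc[OF T S commT] cyc_1[OF T S])
  \<comment> \<open>The terms in \<open>P ** S\<close> cancel: tr (HS) - tr (HP) = tr (HTS) - tr
    (HPU), and by the two bounds this is at least \<mu> (tr S - tr P).\<close>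
  have "0 \<le> \<mu> * (re_trace S - re_trace P)"
    using mu tr by (simp add: mult_nonpos_nonpos)
  moreover have "re_trace (H ** P ** U) = re_trace (H ** P) - re_trace (H ** P ** S)"
    and "re_trace (P ** U) = re_trace P - re_trace (P ** S)"
    and "re_trace (H ** T ** S) = re_trace (H ** S) - re_trace (H ** P ** S)"
    and "re_trace (T ** S) = re_trace S - re_trace (P ** S)"
    by (simp_all add: T_def U_def matrix_expand re_trace_linear)
  ultimately show ?thesis
    using 1 2 by (simp add: right_diff_distrib)
qed

section \<open>Optimality conditions at a local minimum\<close>

text \<open>Dividing by \<open>t\<close> and letting \<open>t\<close> tend to 0 from either side
  gives both signs for \<open>a\<close>; then dividing by the square of \<open>t\<close> bounds
  \<open>b\<close>.\<close>

lemma quartic_local_min_coeffs: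
  fixes a b c d :: real
  assumes ev: "\<forall>\<^sub>F t in nhds 0. 0 \<le> a * t + b * t^2 + c * t^3 + d * t^4"
  shows "a = 0" and "0 \<le> b"
proof -
  have fac: "a * t + b * t^2 + c * t^3 + d * t^4 = t * (a + b * t + c * t^2 + d * t^3)" for t
    by (simp add: algebra_simps power2_eq_square power3_eq_cube power4_eq_xxxx)
  have "\<forall>\<^sub>F t in at_right 0. 0 \<le> a + b * t + c * t^2 + d * t^3"
    unfolding eventually_at_filter using ev
    by eventually_elim (simp only: fac, auto simp: zero_le_mult_iff)
  moreover have "((\<lambda>t. a + b * t + c * t^2 + d * t^3) \<longlongrightarrow> a) (at_right 0)"
    by (auto intro!: tendsto_eq_intros)
  ultimately have a1: "0 \<le> a" by (intro tendsto_lowerbound) auto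
  have "\<forall>\<^sub>F t in at_left 0. a + b * t + c * t^2 + d * t^3 \<le> 0"
    unfolding eventually_at_filter using ev
    by eventually_elim (simp only: fac, auto simp: zero_le_mult_iff)
  moreover have "((\<lambda>t. a + b * t + c * t^2 + d * t^3) \<longlongrightarrow> a) (at_left 0)"
    by (auto intro!: tendsto_eq_intros)
  ultimately have "a \<le> 0" by (intro tendsto_upperbound) auto
  with a1 show a: "a = 0" by simp
  have fac2: "a * t + b * t^2 + c * t^3 + d * t^4 = t^2 * (b + c * t + d * t^2)" for t
    by (simp add: a algebra_simps power2_eq_square power3_eq_cube power4_eq_xxxx)
  have "\<forall>\<^sub>F t in at_right 0. 0 \<le> b + c * t + d * t^2"
    unfolding eventually_at_filter using ev
    by eventually_elim (simp only: fac2, auto simp: zero_le_mult_iff)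
  moreover have "((\<lambda>t. b + c * t + d * t^2) \<longlongrightarrow> b) (at_right 0)"
    by (auto intro!: tendsto_eq_intros)
  ultimately show "0 \<le> b" by (intro tendsto_lowerbound) auto
qed

text \<open>Along the line \<open>X + t *\<^sub>R Z\<close> the Gram product is
  \<open>P + t *\<^sub>R Q + t^2 *\<^sub>R R\<close>, so the energy is a quartic polynomial in
  \<open>t\<close>; the two claims concern its coefficients of degree 1 and 2.\<close>

lemma E0_local_min_conditions:
  fixes H :: "complex^'n^'n" and X Z :: "complex^'m^'n"
  assumes "local_minimum (E0 H) X"
  defines "P \<equiv> X ** ctranspose X" and "Q \<equiv> X ** ctranspose Z + Z ** ctranspose X"
    and "R \<equiv> Z ** ctranspose Z"
  shows "re_trace (H ** (Q + Q - P ** Q - Q ** P)) = 0"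
    and "0 \<le> re_trace (H ** (R + R - Q ** Q - P ** R - R ** P))"
proof -
  let ?a = "re_trace (H ** (Q + Q - P ** Q - Q ** P))"
  let ?b = "re_trace (H ** (R + R - Q ** Q - P ** R - R ** P))"
  let ?c = "- re_trace (H ** (Q ** R + R ** Q))"
  let ?d = "- re_trace (H ** (R ** R))"
  have E: "E0 H (X + t *\<^sub>R Z) = E0 H X + (?a * t + ?b * t^2 + ?c * t^3 + ?d * t^4)" for t
  proof -
    have PQR: "(X + t *\<^sub>R Z) ** ctranspose (X + t *\<^sub>R Z) = P + t *\<^sub>R Q + t^2 *\<^sub>R R"
      by (simp add: P_def Q_def R_def matrix_expand algebra_simps power2_eq_square)
    have E: "E0 H W = re_trace (H ** (W ** ctranspose W + W ** ctranspose W
        - (W ** ctranspose W) ** (W ** ctranspose W)))" for W :: "complex^'m^'n"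
      by (simp add: E0_eq matrix_mul_assoc)
    show ?thesis
      unfolding E PQR unfolding P_def[symmetric]
      by (simp add: matrix_expand re_trace_linear algebra_simps power2_eq_square
          power3_eq_cube power4_eq_xxxx)
  qed
  have "((\<lambda>t::real. X + t *\<^sub>R Z) \<longlongrightarrow> X) (nhds 0)"
    using tendsto_add[OF tendsto_const[of X] tendsto_scaleR[OF filterlim_ident tendsto_const[of Z]],
        of 0] by simp
  then have "\<forall>\<^sub>F t in nhds 0. E0 H X \<le> E0 H (X + t *\<^sub>R Z)"
    using assms(1) unfolding local_minimum_def filterlim_iff by blast
  then have "\<forall>\<^sub>F t in nhds 0. 0 \<le> ?a * t + ?b * t^2 + ?c * t^3 + ?d * t^4"
    by (simp add: E)
  from quartic_local_min_coeffs[OF this] show "?a = 0" and "0 \<le> ?b" by auto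
qed

text \<open>If both matrices had a nonzero entry, a matrix unit \<open>C\<close> linking the column
  of one to the row of the other would make their product appear as an entry.\<close>

lemma sandwich_eq_0:
  fixes A :: "complex^'n^'n" and B :: "complex^'m^'m"
  assumes "\<And>C :: complex^'m^'n. A ** C ** B = 0"
  shows "A = 0 \<or> B = 0"
proof (rule ccontr)
  assume "\<not> (A = 0 \<or> B = 0)"
  then obtain i k l j where nz: "A $ i $ k \<noteq> 0" "B $ l $ j \<noteq> 0"
    by (auto simp: vec_eq_iff)
  define C :: "complex^'m^'n" where "C = (\<chi> p q. if p = k \<and> q = l then 1 else 0)"
  have "(A ** C) $ i $ q = (if q = l then A $ i $ k else 0)" for q
    by (cases "q = l") (simp_all add: matrix_matrix_mult_def C_def if_distrib cong: if_cong)
  then have "(A ** C ** B) $ i $ j = (\<Sum>q\<in>UNIV. (if q = l then A $ i $ k else 0) * B $ q $ j)"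
    by (subst matrix_matrix_mult_def) simp
  also have "\<dots> = (\<Sum>q\<in>UNIV. if q = l then A $ i $ k * B $ q $ j else 0)"
    by (rule sum.cong) auto
  also have "\<dots> = A $ i $ k * B $ l $ j" by simp
  finally show False using assms nz by simp
qed

text \<open>Up to a constant factor the gradient of the energy is \<open>M ** X\<close>. Testing the
  first-order condition in that very direction yields its squared norm, so
  \<open>M ** X = 0\<close>; both claims are then extracted from this equation.\<close>

lemma E0_local_min_critical:
  fixes H :: "complex^'n^'n" and X :: "complex^'m^'n"
  assumes H: "hermitian_neg_def H" and min: "local_minimum (E0 H) X"
  shows "X ** ctranspose X ** X = X"
    and "X ** ctranspose X ** H = H ** (X ** ctranspose X)"
proof -
  note Hc = neg_def_ctranspose[OF H]
  define P where "P = X ** ctranspose X"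
  define G where "G = ctranspose X ** X"
  define M where "M = H + H - H ** P - P ** H"
  have Pc: "ctranspose P = P" by (simp add: P_def ctranspose_mult)
  have Gc: "ctranspose G = G" by (simp add: G_def ctranspose_mult)
  have Mc: "ctranspose M = M" by (simp add: M_def matrix_expand Hc Pc)
  have MX: "M ** X = 0"
  proof -
    define Q where "Q = P ** M + M ** P"
    have Q: "Q = X ** ctranspose (M ** X) + M ** X ** ctranspose X"
      by (simp add: Q_def P_def ctranspose_mult Mc matrix_mul_assoc)
    have "0 = re_trace (H ** (Q + Q - P ** Q - Q ** P))"
      using E0_local_min_conditions(1)[OF min, of "M ** X"] by (simp add: P_def Q)
    also have "\<dots> = re_trace (M ** Q)"
      using re_trace_mult_commute[of "H ** Q" P]
      by (simp add: M_def matrix_expand re_trace_linear)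
    also have "\<dots> = 2 * re_trace (M ** P ** M)"
      using re_trace_mult_commute[of M "M ** P"]
      by (simp add: Q_def matrix_expand re_trace_linear)
    also have "re_trace (M ** P ** M) = re_trace (ctranspose (M ** X) ** (M ** X))"
      using re_trace_mult_commute[of "M ** X" "ctranspose X ** M"]
      by (simp add: P_def ctranspose_mult Mc matrix_mul_assoc)
    finally show ?thesis by (simp add: re_trace_gram_eq_0_iff)
  qed
  define V where "V = mat 1 - G"
  define K where "K = ctranspose X ** H ** X"
  have Vc: "ctranspose V = V" by (simp add: V_def ctranspose_linear Gc)
  \<comment> \<open>Compressing the critical equation by \<open>X\<close> gives a Lyapunov equation
    for \<open>V\<close>. Its product with \<open>V\<close> has trace twice that of
    \<open>V ** K ** V\<close>, and negative definiteness then forces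
    \<open>X ** V = 0\<close>.\<close>
  have "V ** K + K ** V = ctranspose X ** (M ** X)"
    by (simp add: V_def K_def G_def M_def P_def matrix_expand)
  then have VK: "V ** K + K ** V = 0" by (simp add: MX matrix_mult_zero)
  have "2 * re_trace (V ** K ** V) = re_trace ((V ** K + K ** V) ** V)"
    using re_trace_mult_commute[of V "K ** V"] by (simp add: matrix_expand re_trace_linear)
  then have "re_trace (V ** K ** V) = 0" by (simp add: VK matrix_mult_zero re_trace_linear)
  then have "re_trace (ctranspose (X ** V) ** H ** (X ** V)) = 0"
    by (simp add: K_def ctranspose_mult Vc matrix_mul_assoc)
  then have "X ** V = 0" using neg_def_form_definite[OF H, of "X ** V"] by simp
  then show XXX: "X ** ctranspose X ** X = X"
    by (simp add: V_def G_def matrix_expand)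
  have "H ** P ** X = H ** X" by (metis P_def XXX matrix_mul_assoc)
  with MX have "P ** H ** X = H ** X" by (simp add: M_def matrix_expand)
  \<comment> \<open>The range of \<open>P\<close> is invariant under \<open>H\<close>. As the left
    side is Hermitian, so is \<open>H ** P\<close>, which means that \<open>P\<close> and
    \<open>H\<close> commute.\<close>
  then have 1: "P ** H ** P = H ** P" by (simp add: P_def matrix_mul_assoc)
  have "P ** H = ctranspose (H ** P)" by (simp add: ctranspose_mult Pc Hc)
  also have "\<dots> = H ** P"
    unfolding 1[symmetric] by (simp add: ctranspose_mult Pc Hc matrix_mul_assoc)
  finally show "X ** ctranspose X ** H = H ** (X ** ctranspose X)" by (simp add: P_def)
qed

text \<open>If neither alternative holds, adding a multiple of \<open>vw\<^sup>*\<close> with \<open>X\<^sup>*v = 0\<close> and \<open>Xw = 0\<close>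
  decreases the energy to second order.\<close>

lemma E0_local_min_full_rank:
  fixes H :: "complex^'n^'n" and X :: "complex^'m^'n"
  assumes H: "hermitian_neg_def H" and min: "local_minimum (E0 H) X"
  shows "X ** ctranspose X = mat 1 \<or> ctranspose X ** X = mat 1"
proof -
  define P where "P = X ** ctranspose X"
  define G where "G = ctranspose X ** X"
  have XXX: "X ** ctranspose X ** X = X" by (rule E0_local_min_critical(1)[OF H min])
  have Pc: "ctranspose P = P" by (simp add: P_def ctranspose_mult)
  have Gc: "ctranspose G = G" by (simp add: G_def ctranspose_mult)
  have PP: "P ** P = P" by (simp add: P_def XXX matrix_mul_assoc)
  have XG: "X ** G = X" by (simp add: G_def XXX matrix_mul_assoc)
  have "(mat 1 - P) ** C ** (mat 1 - G) = 0" for C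
  proof -
    define Z where "Z = (mat 1 - P) ** C ** (mat 1 - G)"
    have XZ: "X ** ctranspose Z = 0"
      by (simp add: Z_def matrix_expand Gc Pc XG)
    then have ZX: "Z ** ctranspose X = 0"
      by (metis ctranspose_ctranspose ctranspose_linear(4) ctranspose_mult)
    have PZ: "P ** Z = 0" by (simp add: Z_def matrix_expand PP)
    then have ZP: "ctranspose Z ** P = 0"
      by (metis Pc ctranspose_linear(4) ctranspose_mult)
    \<comment> \<open>For this \<open>Z\<close> the first-order variation of
      \<open>X ** ctranspose X\<close> vanishes, and \<open>P\<close> annihilates
      \<open>Z ** ctranspose Z\<close> on both sides, so only the doubled term of the second-order
      condition survives.\<close>
    have "0 \<le> re_trace (H ** (Z ** ctranspose Z + Z ** ctranspose Z))"
      using E0_local_min_conditions(2)[OF min, of Z] PZ ZP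
      by (simp add: XZ ZX P_def[symmetric] matrix_mult_zero matrix_mul_assoc)
        (simp add: matrix_mult_zero flip: matrix_mul_assoc)
    also have "\<dots> = 2 * re_trace (ctranspose Z ** H ** Z)"
      using re_trace_mult_commute[of "H ** Z" "ctranspose Z"]
      by (simp add: matrix_expand re_trace_linear)
    finally have "Z = 0" using neg_def_form_definite[OF H, of Z] by simp
    then show ?thesis by (simp add: Z_def)
  qed
  from sandwich_eq_0[OF this] show ?thesis by (auto simp: P_def G_def)
qed

text \<open>Perturbing \<open>X\<close> along \<open>vu\<^sup>*X\<close> rotates \<open>u\<close> towards \<open>v\<close>.\<close>

lemma E0_local_min_rotation:
  fixes H :: "complex^'n^'n" and X :: "complex^'m^'n" and u v :: "complex^1^'n"
  assumes min: "local_minimum (E0 H) X"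
    and u: "X ** ctranspose X ** u = u" and v: "X ** ctranspose X ** v = 0"
  shows "re_trace (ctranspose v ** v) * re_trace (ctranspose u ** H ** u)
    \<le> re_trace (ctranspose u ** u) * re_trace (ctranspose v ** H ** v)"
proof -
  define P where "P = X ** ctranspose X"
  define a b where "a = re_trace (ctranspose u ** u)" and "b = re_trace (ctranspose v ** v)"
  define Z where "Z = v ** ctranspose u ** X"
  have Pc: "ctranspose P = P" by (simp add: P_def ctranspose_mult)
  have Pu: "P ** u = u" and Pv: "P ** v = 0" using u v by (simp_all add: P_def)
  have uP: "ctranspose u ** P = ctranspose u" and vP: "ctranspose v ** P = 0"
    by (metis Pc Pu ctranspose_mult, metis Pc Pv ctranspose_linear(4) ctranspose_mult)
  have uv: "ctranspose u ** v = 0"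
    by (metis Pv matrix_mul_assoc matrix_mult_zero(2) uP)
  then have vu: "ctranspose v ** u = 0"
    by (metis ctranspose_ctranspose ctranspose_linear(4) ctranspose_mult)
  have uu: "ctranspose u ** u = a *\<^sub>R mat 1" and vv: "ctranspose v ** v = b *\<^sub>R mat 1"
    unfolding a_def b_def by (rule gram_column)+
  have ZX: "Z ** ctranspose X = v ** ctranspose u"
    by (simp add: Z_def uP flip: matrix_mul_assoc P_def)
  then have XZ: "X ** ctranspose Z = u ** ctranspose v"
    by (metis ctranspose_ctranspose ctranspose_mult)
  have "Z ** ctranspose Z = v ** ctranspose u ** (X ** ctranspose Z)"
    by (simp add: Z_def matrix_mul_assoc)
  also have "\<dots> = v ** (ctranspose u ** u) ** ctranspose v"
    by (simp add: XZ matrix_mul_assoc)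
  also have "\<dots> = a *\<^sub>R (v ** ctranspose v)"
    by (simp add: uu matrix_expand)
  finally have ZZ: "Z ** ctranspose Z = a *\<^sub>R (v ** ctranspose v)" .
  define Q where "Q = u ** ctranspose v + v ** ctranspose u"
  have "Q ** Q = u ** (ctranspose v ** u) ** ctranspose v + u ** (ctranspose v ** v) ** ctranspose u
      + v ** (ctranspose u ** u) ** ctranspose v + v ** (ctranspose u ** v) ** ctranspose u"
    by (simp add: Q_def matrix_expand)
  then have QQ: "Q ** Q = b *\<^sub>R (u ** ctranspose u) + a *\<^sub>R (v ** ctranspose v)"
    by (simp add: uu vv uv vu matrix_mult_zero matrix_scaleR_mult)
  have PZZ: "P ** (a *\<^sub>R (v ** ctranspose v)) = 0"
    by (simp add: matrix_expand Pv)
  have ZZP: "(a *\<^sub>R (v ** ctranspose v)) ** P = 0"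
    by (simp add: matrix_scaleR_mult matrix_mult_zero vP flip: matrix_mul_assoc)
  have "0 \<le> re_trace (H ** (a *\<^sub>R (v ** ctranspose v) + a *\<^sub>R (v ** ctranspose v) - Q ** Q))"
    using E0_local_min_conditions(2)[OF min, of Z]
    unfolding ZZ ZX XZ P_def[symmetric] Q_def[symmetric] PZZ ZZP by simp
  \<comment> \<open>One of the two copies of the \<open>v\<close> term cancels against the one
    contained in \<open>Q ** Q\<close>.\<close>
  also have "\<dots> = a * re_trace (H ** v ** ctranspose v) - b * re_trace (H ** u ** ctranspose u)"
    by (simp add: QQ matrix_expand re_trace_linear)
  also have "re_trace (H ** v ** ctranspose v) = re_trace (ctranspose v ** H ** v)"
    using re_trace_mult_commute[of "H ** v" "ctranspose v"] by (simp add: matrix_mul_assoc)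
  also have "re_trace (H ** u ** ctranspose u) = re_trace (ctranspose u ** H ** u)"
    using re_trace_mult_commute[of "H ** u" "ctranspose u"] by (simp add: matrix_mul_assoc)
  finally show ?thesis by (simp add: a_def b_def)
qed

text \<open>Take \<mu> to be the supremum of the Rayleigh quotients of \<open>H\<close> over the
  nonzero vectors fixed by \<open>X ** ctranspose X\<close>. The rotation inequality bounds each of
  them by every quotient on the kernel, and a nonzero column of \<open>X\<close> shows that the
  supremum is over a nonempty set.\<close>

lemma E0_local_min_separation:
  fixes H :: "complex^'n^'n" and X :: "complex^'m^'n"
  assumes H: "hermitian_neg_def H" and min: "local_minimum (E0 H) X" and X: "X \<noteq> 0"
  obtains \<mu> where "\<mu> \<le> 0"
    and "\<And>u :: complex^1^'n. X ** ctranspose X ** u = u \<Longrightarrow>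
      re_trace (ctranspose u ** H ** u) \<le> \<mu> * re_trace (ctranspose u ** u)"
    and "\<And>v :: complex^1^'n. X ** ctranspose X ** v = 0 \<Longrightarrow>
      \<mu> * re_trace (ctranspose v ** v) \<le> re_trace (ctranspose v ** H ** v)"
proof -
  define q where "q u = re_trace (ctranspose u ** H ** u) / re_trace (ctranspose u ** u)"
    for u :: "complex^1^'n"
  define U where "U = {u :: complex^1^'n. X ** ctranspose X ** u = u \<and> u \<noteq> 0}"
  have pos: "0 < re_trace (ctranspose u ** u)" if "u \<noteq> 0" for u :: "complex^1^'n"
    using that re_trace_gram_nonneg[of u] re_trace_gram_eq_0_iff[of u] by linarith
  have q: "q u \<le> 0" for u
    unfolding q_def using neg_def_form_nonpos[OF H] re_trace_gram_nonneg
    by (rule divide_nonpos_nonneg)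
  then have bdd: "bdd_above (q ` U)" by (auto simp: bdd_above_def)
  have ne: "U \<noteq> {}"
  proof -
    obtain j where "column j X \<noteq> 0" using X by (auto simp: vec_eq_iff column_def)
    then have "columnvector (column j X) \<noteq> (0 :: complex^1^'n)"
      by (simp add: columnvector_def vec_eq_iff)
    then have "columnvector (column j X) \<in> U"
      by (simp add: U_def mult_columnvector_column E0_local_min_critical(1)[OF H min])
    then show ?thesis by blast
  qed
  show thesis
  proof
    show "(SUP u\<in>U. q u) \<le> 0" using ne q by (rule cSUP_least)
  next
    fix u :: "complex^1^'n"
    assume u: "X ** ctranspose X ** u = u"
    show "re_trace (ctranspose u ** H ** u) \<le> (SUP u\<in>U. q u) * re_trace (ctranspose u ** u)"
    proof (cases "u = 0")
      case True
      then show ?thesis by (simp add: matrix_mult_zero re_trace_linear)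
    next
      case False
      with u have "q u \<le> (SUP u\<in>U. q u)" by (intro cSUP_upper bdd) (simp add: U_def)
      with pos[OF False] show ?thesis by (simp add: q_def field_simps)
    qed
  next
    fix v :: "complex^1^'n"
    assume v: "X ** ctranspose X ** v = 0"
    show "(SUP u\<in>U. q u) * re_trace (ctranspose v ** v) \<le> re_trace (ctranspose v ** H ** v)"
    proof (cases "v = 0")
      case True
      then show ?thesis by (simp add: matrix_mult_zero re_trace_linear)
    next
      case False
      have "(SUP u\<in>U. q u) \<le> q v"
      proof (rule cSUP_least[OF ne])
        fix u assume "u \<in> U"
        then have u: "X ** ctranspose X ** u = u" "u \<noteq> 0" by (simp_all add: U_def)
        from E0_local_min_rotation[OF min u(1) v] pos[OF u(2)] pos[OF False]
        show "q u \<le> q v" by (simp add: q_def field_simps)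
      qed
      with pos[OF False] show ?thesis by (simp add: q_def field_simps)
    qed
  qed
qed

theorem theorem2:
  fixes H :: "complex^'N^'N" and X :: "complex^'m^'N"
  assumes "hermitian_neg_def H"
    and "local_minimum (E0 H) X"
  shows "global_minimum (E0 H) X"
proof -
  note critical = E0_local_min_critical[OF assms]
  define P where "P = X ** ctranspose X"
  have P: "orth_proj P"
    by (simp add: P_def orth_proj_def ctranspose_mult matrix_mul_assoc critical(1))
  \<comment> \<open>Idempotence of \<open>P\<close> reduces 2P - PP to \<open>P\<close>.\<close>
  have EX: "E0 H X = re_trace (H ** P)"
    by (simp add: E0_eq critical(1) matrix_expand re_trace_linear P_def)
  have "re_trace (H ** P) \<le> E0 H Y" for Y :: "complex^'m^'N"
  proof (cases "P = mat 1")
    case True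
    with E0_lower_bound_trace[OF assms(1), of Y] show ?thesis by simp
  next
    case False
    then have G: "ctranspose X ** X = mat 1"
      using E0_local_min_full_rank[OF assms] by (simp add: P_def)
    \<comment> \<open>The trace is the number of columns, which is positive; hence \<open>X\<close>
      is nonzero, as the separation lemma requires.\<close>
    then have "re_trace (ctranspose X ** X) \<noteq> 0" by (simp add: re_trace_mat_1)
    then have "X \<noteq> 0" by (simp add: re_trace_gram_eq_0_iff)
    then obtain \<mu> where "\<mu> \<le> 0"
      and "\<And>u :: complex^1^'N. P ** u = u \<Longrightarrow>
        re_trace (ctranspose u ** H ** u) \<le> \<mu> * re_trace (ctranspose u ** u)"
      and "\<And>v :: complex^1^'N. P ** v = 0 \<Longrightarrow>
        \<mu> * re_trace (ctranspose v ** v) \<le> re_trace (ctranspose v ** H ** v)"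
      using E0_local_min_separation[OF assms] unfolding P_def by metis
    note mu = this
    obtain S where S: "orth_proj S" "re_trace S \<le> CARD('m)" "S ** Y = Y"
      by (rule orth_proj_columns)
    \<comment> \<open>Orthonormal columns give \<open>P\<close> the largest rank allowed for
      \<open>S\<close>, so the trace comparison goes the right way.\<close>
    have "re_trace P = CARD('m)"
      using re_trace_mult_commute[of X "ctranspose X"] by (simp add: P_def G re_trace_mat_1)
    with S(2) have "re_trace S \<le> re_trace P" by simp
    with P S(1) have "re_trace (H ** P) \<le> re_trace (H ** S)"
      using critical(2) mu unfolding P_def[symmetric] by (intro re_trace_proj_minimal)
    also have "\<dots> \<le> E0 H Y" by (rule E0_lower_bound[OF assms(1) S(1,3)])
    finally show ?thesis .
  qed
  then show ?thesis by (simp add: global_minimum_def EX)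
qed

end
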